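(* Let $d,N\in\mathbb{N}$, let $\|\cdot\|$ be the Euclidean norm on $\mathbb{R}^d$ (so the dual norm $\|\cdot\|_*$ is also Euclidean), let $f_1,\dots,f_N:\mathbb{R}^d\to\mathbb{R}$ be differentiable, let $h:\mathbb{R}^d\to\mathbb{R}\cup\{+\infty\}$ be a proper convex function, and set $F:=\sum_{n=1}^N f_n$. Assume: (A1) $F$ is $\mu$-strongly convex for some $\mu>0$: $F(x)\ge F(y)+\langle\nabla F(y),x-y\rangle+\frac{\mu}{2}\|x-y\|^2$ for all $x,y\in\mathbb{R}^d$. (A2) Each $f_n$ is convex with $L_n$-Lipschitz gradient: $\|\nabla f_n(x)-\nabla f_n(y)\|_*\le L_n\|x-y\|$ for all $x,y\in\mathbb{R}^d$. (A3) $h$ is subdifferentiable everywhere in its effective domain: for all $x,y\in\{z\in\mathbb{R}^d: h(z)<+\infty\}$, $\partial h(y)\neq\emptyset$ and $h(x)\ge h(y)+\langle s(y),x-y\rangle$ for all $s(y)\in\partial h(y)$. (A4) There is a non-negative integer $\bar\tau$ such that the delays satisfy $\tau_k^n\in\{0,1,\dots,\bar\tau\}$ for all $k\in\mathbb{N}_0$ and $n\in\{1,\dots,N\}$. Let $L=\sum_{n=1}^N L_n$, let $x^\star$ be the minimizer of $F+h$ over $\mathbb{R}^d$, and let the step-size $\alpha>0$ satisfy $$\alpha\le\frac{\left(1+\frac{\mu}{L}\,\frac{1}{\bar\tau+1}\right)^{\frac{1}{\bar\tau+1}}-1}{\mu}.$$ Then the iterates $(x_k)_{k\ge 0}$ generated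 by the asynchronous proximal incremental aggregated gradient method with step-size $\alpha$, delays $\tau_k^n$ and initial point $x_0\in\mathbb{R}^d$ satisfy, for all $k\ge 0$, $$\|x_k-x^\star\|^2\le\left(\frac{1}{\mu\alpha+1}\right)^k\|x_0-x^\star\|^2 .$$
   Context: $\mathbb{N}_0$ is the set of non-negative integers. The problem is to minimize $\sum_{n=1}^N f_n(x)+h(x)$ over $x\in\mathbb{R}^d$. The asynchronous proximal incremental aggregated gradient method: given $x_0\in\mathbb{R}^d$, a step-size $\alpha>0$ and integer delays $\tau_k^n\ge 0$, for $k=0,1,2,\dots$ put $$g_k=\sum_{n=1}^N\nabla f_n\left(x_{k-\tau_k^n}\right),\qquad x_{k+1}=\operatorname*{arg\,min}_{x\in\mathbb{R}^d}\left\{\langle g_k,x-x_k\rangle+\frac{1}{2\alpha}\|x-x_k\|^2+h(x)\right\},$$ with the convention $x_j=x_0$ for $j<0$. The iterates are understood to be well defined (i.e. each $x_{k+1}$ is a minimizer of the displayed subproblem), and $x^\star$ is understood to exist. (In the parameter-server implementation, a master performs the proximal step, and workers holding disjoint groups of components return gradients evaluated at stale iterates; $\tau_k^n$ is the staleness of the most recent gradient of $f_n$ available to the master at iteration $k$.) *)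

theory Defs
  imports "HOL-Analysis.Analysis"
begin

definition gradient :: "('a::real_inner \<Rightarrow> real) \<Rightarrow> 'a \<Rightarrow> 'a"
  where "gradient f x = (THE D. GDERIV f x :> D)"

lemma gradient_eqI:
  fixes f :: "'a::real_inner \<Rightarrow> real"
  assumes "GDERIV f x :> D"
  shows "gradient f x = D"
  unfolding gradient_def
proof (rule the_equality)
  show "GDERIV f x :> D" by (rule assms)
next
  fix E assume "GDERIV f x :> E"
  then have "(\<lambda>v. v \<bullet> E) = (\<lambda>v. v \<bullet> D)"
    using assms has_derivative_unique unfolding gderiv_def by blast
  then show "E = D"
    unfolding fun_eq_iff vector_eq_ldot .
qed

lemma GDERIV_gradient:
  fixes f :: "'a::euclidean_space \<Rightarrow> real"
  assumes "f differentiable (at x)"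
  shows "GDERIV f x :> gradient f x"
proof -
  obtain f' where f': "(f has_derivative f') (at x)"
    using assms unfolding differentiable_def by blast
  then have lin: "linear f'"
    by (rule has_derivative_linear)
  have "f' = (\<lambda>v. v \<bullet> adjoint f' 1)"
    by (simp add: fun_eq_iff adjoint_works[OF lin])
  with f' have D: "GDERIV f x :> adjoint f' 1"
    unfolding gderiv_def by (rule back_subst)
  show ?thesis
    unfolding gradient_eqI[OF D] by (rule D)
qed

definition strongly_convex :: "real \<Rightarrow> ('a::real_inner \<Rightarrow> real) \<Rightarrow> bool"
  where "strongly_convex \<mu> f \<longleftrightarrow>
    (\<forall>x y. f x \<ge> f y + gradient f y \<bullet> (x - y) + \<mu> / 2 * (norm (x - y))\<^sup>2)"

definition effective_domain :: "('a \<Rightarrow> ereal) \<Rightarrow> 'a set"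
  where "effective_domain h = {x. h x < \<infinity>}"

definition proper_fun :: "('a \<Rightarrow> ereal) \<Rightarrow> bool"
  where "proper_fun h \<longleftrightarrow> (\<forall>x. h x \<noteq> -\<infinity>) \<and> effective_domain h \<noteq> {}"

(* The convention 0 * \<infinity> = 0 of ereal makes the cases u = 0 and v = 0 harmless. *)
definition convex_ereal :: "('a::real_vector \<Rightarrow> ereal) \<Rightarrow> bool"
  where "convex_ereal h \<longleftrightarrow>
    (\<forall>x y. \<forall>u\<ge>0. \<forall>v\<ge>0. u + v = 1 \<longrightarrow>
      h (u *\<^sub>R x + v *\<^sub>R y) \<le> ereal u * h x + ereal v * h y)"

definition subdifferential :: "('a::real_inner \<Rightarrow> ereal) \<Rightarrow> 'a \<Rightarrow> 'a set"
  where "subdifferential h y = {s. \<forall>z. h z \<ge> h y + ereal (s \<bullet> (z - y))}"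

(* The delay of component n at iteration k is \<tau> k n. Truncated subtraction on nat
   implements the convention that iterates with negative index equal x 0. *)
definition aggregated_gradient ::
  "nat \<Rightarrow> (nat \<Rightarrow> 'a::real_inner \<Rightarrow> real) \<Rightarrow> (nat \<Rightarrow> nat \<Rightarrow> nat) \<Rightarrow> (nat \<Rightarrow> 'a) \<Rightarrow> nat \<Rightarrow> 'a"
  where "aggregated_gradient N f \<tau> x k = (\<Sum>n=1..N. gradient (f n) (x (k - \<tau> k n)))"

definition piag_iterates ::
  "nat \<Rightarrow> (nat \<Rightarrow> 'a::real_inner \<Rightarrow> real) \<Rightarrow> ('a \<Rightarrow> ereal) \<Rightarrow> real \<Rightarrow>
    (nat \<Rightarrow> nat \<Rightarrow> nat) \<Rightarrow> 'a \<Rightarrow> (nat \<Rightarrow> 'a) \<Rightarrow> bool"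
  where "piag_iterates N f h \<alpha> \<tau> x0 x \<longleftrightarrow>
    x 0 = x0 \<and>
    (\<forall>k. is_arg_min
      (\<lambda>y. ereal (aggregated_gradient N f \<tau> x k \<bullet> (y - x k)
              + 1 / (2 * \<alpha>) * (norm (y - x k))\<^sup>2) + h y)
      (\<lambda>_. True) (x (Suc k)))"

end

(* The master step minimizes a (1/alpha)-strongly convex function, and xstar minimizes a
   mu-strongly convex one; both yield quadratic growth around the minimizer. Combined with
   smoothness and convexity of each f n at its stale iterate, this gives
     (1 + mu alpha) |x (k+1) - xstar|^2
       <= |x k - xstar|^2 - |x (k+1) - x k|^2
          + alpha L (tau+1) * (sum of |x (j+1) - x j|^2 over k - tau <= j <= k).
   After weighting the k-th inequality with (1 + mu alpha)^k and summing, the step-size bound is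
   exactly what makes the negative terms absorb the delayed ones. *)
theory Submission
  imports Defs
begin

section \<open>Growth of composite functions around a minimizer\<close>

text \<open>Compare with a point of the effective domain. Finiteness lets the later estimates be
  stated in \<open>real\<close> instead of \<open>ereal\<close>.\<close>

lemma composite_minimizer_finite:
  assumes "proper_fun h"
    and "is_arg_min (\<lambda>u. ereal (G u) + h u) (\<lambda>_. True) z"
  shows "\<bar>h z\<bar> \<noteq> \<infinity>"
proof -
  obtain u where u: "h u < \<infinity>"
    using assms(1) by (auto simp: proper_fun_def effective_domain_def)
  have "ereal (G z) + h z \<le> ereal (G u) + h u"
    using assms(2) by (simp add: is_arg_min_linorder)
  then have "h z \<noteq> \<infinity>" using u by (cases "h u") auto
  then show ?thesis using assms(1) by (auto simp: proper_fun_def)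
qed

text \<open>The minimizer is compared with points of the segment from \<open>z\<close> to
  \<open>y\<close>, which then tend to \<open>z\<close>. Strong convexity enters only as the segment
  inequality \<open>sc\<close>, so that the lemma serves both \<open>F\<close> and the quadratic
  model of the proximal step.\<close>

lemma composite_minimizer_growth:
  fixes G :: "'a::real_inner \<Rightarrow> real"
  assumes sc: "\<And>t. 0 < t \<Longrightarrow> t < 1 \<Longrightarrow>
      G (t *\<^sub>R y + (1 - t) *\<^sub>R z)
        \<le> t * G y + (1 - t) * G z - \<sigma> / 2 * t * (1 - t) * (norm (y - z))\<^sup>2"
    and h: "convex_ereal h"
    and min: "is_arg_min (\<lambda>u. ereal (G u) + h u) (\<lambda>_. True) z"
    and hz: "h z = ereal a" and hy: "h y = ereal b"
  shows "G z + a + \<sigma> / 2 * (norm (y - z))\<^sup>2 \<le> G y + b"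
proof -
  \<comment> \<open>Division by \<open>t\<close> leaves the factor \<open>1 - t\<close> on the
    growth term. With this factor named \<open>s\<close>, the limit \<open>t\<close> to 0 becomes
    \<open>s\<close> to 1, which \<open>field_le_mult_one_interval\<close> takes.\<close>
  have "s * (\<sigma> / 2 * (norm (y - z))\<^sup>2) \<le> G y + b - (G z + a)" if s: "0 < s" "s < 1" for s
  proof -
    define t where "t = 1 - s"
    have t: "0 < t" "t < 1" using s by (auto simp: t_def)
    let ?u = "t *\<^sub>R y + (1 - t) *\<^sub>R z"
    have "h ?u \<le> ereal t * h y + ereal (1 - t) * h z"
      using h t unfolding convex_ereal_def by simp
    then have "ereal (G ?u) + h ?u \<le> ereal (G ?u) + ereal (t * b + (1 - t) * a)"
      unfolding hz hy by (intro add_left_mono) simp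
    moreover have "ereal (G z) + h z \<le> ereal (G ?u) + h ?u"
      using min by (simp add: is_arg_min_linorder)
    ultimately have "G z + a \<le> G ?u + (t * b + (1 - t) * a)"
      unfolding hz using order_trans by fastforce
    with sc[OF t] have
      "t * ((1 - t) * (\<sigma> / 2 * (norm (y - z))\<^sup>2)) \<le> t * (G y + b - (G z + a))"
      by (simp add: algebra_simps)
    then show ?thesis using t by (simp add: t_def)
  qed
  then have "\<sigma> / 2 * (norm (y - z))\<^sup>2 \<le> G y + b - (G z + a)"
    by (rule field_le_mult_one_interval)
  then show ?thesis by simp
qed

text \<open>Being an equality, this gives the quadratic of the proximal step its exact modulus
  \<open>1 / \<alpha>\<close>.\<close>

lemma norm_convex_combination_sq:
  fixes p q :: "'a::real_inner"
  shows "(norm (t *\<^sub>R p + (1 - t) *\<^sub>R q))\<^sup>2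
    = t * (norm p)\<^sup>2 + (1 - t) * (norm q)\<^sup>2 - t * (1 - t) * (norm (p - q))\<^sup>2"
  unfolding power2_norm_eq_inner inner_simps inner_commute[of q p] by algebra

text \<open>The first-order inequality is taken at the intermediate point \<open>?u\<close>, towards
  \<open>y\<close> and towards \<open>z\<close>. With weights \<open>t\<close> and
  \<open>1 - t\<close> the terms in \<open>g\<close> cancel.\<close>

lemma strongly_convex_combination:
  assumes sc: "strongly_convex \<mu> F" and t: "0 < t" "t < 1"
  shows "F (t *\<^sub>R y + (1 - t) *\<^sub>R z)
    \<le> t * F y + (1 - t) * F z - \<mu> / 2 * t * (1 - t) * (norm (y - z))\<^sup>2"
proof -
  let ?u = "t *\<^sub>R y + (1 - t) *\<^sub>R z"
  define g where "g = gradient F ?u"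
  have y: "y - ?u = (1 - t) *\<^sub>R (y - z)" and z: "z - ?u = - t *\<^sub>R (y - z)"
    by (simp_all add: algebra_simps)
  have "F ?u + g \<bullet> (y - ?u) + \<mu> / 2 * (norm (y - ?u))\<^sup>2 \<le> F y"
    "F ?u + g \<bullet> (z - ?u) + \<mu> / 2 * (norm (z - ?u))\<^sup>2 \<le> F z"
    using sc by (auto simp: strongly_convex_def g_def)
  then have "F ?u + (1 - t) * (g \<bullet> (y - z)) + \<mu> / 2 * ((1 - t)\<^sup>2 * (norm (y - z))\<^sup>2) \<le> F y"
    "F ?u - t * (g \<bullet> (y - z)) + \<mu> / 2 * (t\<^sup>2 * (norm (y - z))\<^sup>2) \<le> F z"
    unfolding y z by (simp_all add: power_mult_distrib)
  then have "t * (F ?u + (1 - t) * (g \<bullet> (y - z)) + \<mu> / 2 * ((1 - t)\<^sup>2 * (norm (y - z))\<^sup>2))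
      + (1 - t) * (F ?u - t * (g \<bullet> (y - z)) + \<mu> / 2 * (t\<^sup>2 * (norm (y - z))\<^sup>2))
    \<le> t * F y + (1 - t) * F z"
    using t by (intro add_mono mult_left_mono) auto
  \<comment> \<open>The quadratic weights add up by t (1 - t)^2 + (1 - t) t^2 = t (1 - t).\<close>
  moreover have "t * (F ?u + (1 - t) * (g \<bullet> (y - z)) + \<mu> / 2 * ((1 - t)\<^sup>2 * (norm (y - z))\<^sup>2))
      + (1 - t) * (F ?u - t * (g \<bullet> (y - z)) + \<mu> / 2 * (t\<^sup>2 * (norm (y - z))\<^sup>2))
    = F ?u + \<mu> / 2 * t * (1 - t) * (norm (y - z))\<^sup>2"
    by (simp add: field_simps power2_eq_square)
  ultimately show ?thesis by simp
qed

text \<open>The three-point inequality of a proximal step: quadratic growth of the subproblem around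
  its minimizer \<open>z\<close> with modulus \<open>1 / \<alpha>\<close>, multiplied by
  \<open>2 * \<alpha>\<close>.\<close>

lemma prox_step_inequality:
  fixes g v y z :: "'a::real_inner"
  assumes "\<alpha> > 0" "convex_ereal h"
    and "is_arg_min (\<lambda>y. ereal (g \<bullet> (y - v) + 1 / (2 * \<alpha>) * (norm (y - v))\<^sup>2) + h y) (\<lambda>_. True) z"
    and "h z = ereal a" "h y = ereal b"
  shows "2 * \<alpha> * (g \<bullet> (z - y) + a - b)
    \<le> (norm (v - y))\<^sup>2 - (norm (z - v))\<^sup>2 - (norm (z - y))\<^sup>2"
proof -
  have "g \<bullet> (z - v) + 1 / (2 * \<alpha>) * (norm (z - v))\<^sup>2 + a + 1 / \<alpha> / 2 * (norm (y - z))\<^sup>2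
    \<le> g \<bullet> (y - v) + 1 / (2 * \<alpha>) * (norm (y - v))\<^sup>2 + b"
  proof (rule composite_minimizer_growth[OF _ assms(2-5)])
    fix t :: real
    have "t *\<^sub>R y + (1 - t) *\<^sub>R z - v = t *\<^sub>R (y - v) + (1 - t) *\<^sub>R (z - v)"
      by (simp add: algebra_simps)
    then show "g \<bullet> (t *\<^sub>R y + (1 - t) *\<^sub>R z - v)
        + 1 / (2 * \<alpha>) * (norm (t *\<^sub>R y + (1 - t) *\<^sub>R z - v))\<^sup>2
      \<le> t * (g \<bullet> (y - v) + 1 / (2 * \<alpha>) * (norm (y - v))\<^sup>2)
        + (1 - t) * (g \<bullet> (z - v) + 1 / (2 * \<alpha>) * (norm (z - v))\<^sup>2)
        - 1 / \<alpha> / 2 * t * (1 - t) * (norm (y - z))\<^sup>2"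
      by (simp only: norm_convex_combination_sq inner_add_right inner_scaleR_right
          diff_diff_eq2 diff_add_cancel) (simp add: algebra_simps add_divide_distrib diff_divide_distrib)
  qed
  then have "2 * \<alpha> * (g \<bullet> (z - v) + 1 / (2 * \<alpha>) * (norm (z - v))\<^sup>2 + a + 1 / \<alpha> / 2 * (norm (y - z))\<^sup>2)
    \<le> 2 * \<alpha> * (g \<bullet> (y - v) + 1 / (2 * \<alpha>) * (norm (y - v))\<^sup>2 + b)"
    using \<open>\<alpha> > 0\<close> by (intro mult_left_mono) auto
  then show ?thesis
    using \<open>\<alpha> > 0\<close> by (simp add: algebra_simps norm_minus_commute)
qed

section \<open>Smooth convex functions\<close>

lemma gradient_has_real_derivative_along_line:
  fixes f :: "'a::euclidean_space \<Rightarrow> real"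
  assumes "f differentiable_on UNIV"
  shows "((\<lambda>t. f (u + t *\<^sub>R v)) has_real_derivative gradient f (u + t *\<^sub>R v) \<bullet> v) (at t)"
proof -
  have "(f has_derivative (\<lambda>w. w \<bullet> gradient f (u + t *\<^sub>R v))) (at (u + t *\<^sub>R v))"
    using assms GDERIV_gradient[of f "u + t *\<^sub>R v"]
    by (simp add: differentiable_on_def gderiv_def)
  moreover have "((\<lambda>t. u + t *\<^sub>R v) has_derivative (\<lambda>s. s *\<^sub>R v)) (at t)"
    by (auto intro!: derivative_eq_intros)
  ultimately have "((\<lambda>t. f (u + t *\<^sub>R v)) has_derivative (\<lambda>s. (s *\<^sub>R v) \<bullet> gradient f (u + t *\<^sub>R v))) (at t)"
    by (rule has_derivative_compose[rotated])
  then show ?thesis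
    by (simp add: has_field_derivative_def inner_commute mult.commute[of _ "_ \<bullet> _"])
qed

text \<open>Restricted to the line through \<open>u\<close> and \<open>y\<close>, \<open>f\<close>
  lies above its tangent at parameter 0; this is evaluated at parameter 1.\<close>

lemma convex_gradient_inequality:
  fixes f :: "'a::euclidean_space \<Rightarrow> real"
  assumes diff: "f differentiable_on UNIV" and conv: "convex_on UNIV f"
  shows "f u + gradient f u \<bullet> (y - u) \<le> f y"
proof -
  define \<phi> where "\<phi> = (\<lambda>t. f (u + t *\<^sub>R (y - u)))"
  have "convex_on UNIV \<phi>"
  proof (rule convex_onI)
    fix t p q :: real
    assume "0 < t" "t < 1"
    moreover have "u + ((1 - t) *\<^sub>R p + t *\<^sub>R q) *\<^sub>R (y - u)
      = (1 - t) *\<^sub>R (u + p *\<^sub>R (y - u)) + t *\<^sub>R (u + q *\<^sub>R (y - u))"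
      by (simp add: algebra_simps)
    ultimately show "\<phi> ((1 - t) *\<^sub>R p + t *\<^sub>R q) \<le> (1 - t) * \<phi> p + t * \<phi> q"
      using convex_onD[OF conv, of t] unfolding \<phi>_def by simp
  qed auto
  moreover have "(\<phi> has_real_derivative gradient f u \<bullet> (y - u)) (at 0)"
    using gradient_has_real_derivative_along_line[OF diff, of u "y - u" 0] by (simp add: \<phi>_def)
  ultimately have "\<phi> 1 - \<phi> 0 \<ge> gradient f u \<bullet> (y - u) * (1 - 0)"
    by (intro convex_on_imp_above_tangent[of UNIV]) auto
  then show ?thesis by (simp add: \<phi>_def)
qed

lemma lipschitz_gradient_upper_bound:
  fixes f :: "'a::euclidean_space \<Rightarrow> real"
  assumes diff: "f differentiable_on UNIV" and lip: "C-lipschitz_on UNIV (gradient f)"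
  shows "f y \<le> f u + gradient f u \<bullet> (y - u) + C / 2 * (norm (y - u))\<^sup>2"
proof -
  let ?v = "y - u"
  \<comment> \<open>The gap between \<open>f\<close> and its quadratic upper model along the
    segment. By Cauchy-Schwarz and the Lipschitz bound its derivative is nonpositive on
    [0, 1].\<close>
  define \<psi> where
    "\<psi> = (\<lambda>t. f (u + t *\<^sub>R ?v) - t * (gradient f u \<bullet> ?v) - C / 2 * t\<^sup>2 * (norm ?v)\<^sup>2)"
  have "\<psi> 1 \<le> \<psi> 0"
  proof (rule DERIV_nonpos_imp_nonincreasing[of 0 1 \<psi>])
    fix t :: real assume t: "0 \<le> t" "t \<le> 1"
    have "(\<psi> has_real_derivative gradient f (u + t *\<^sub>R ?v) \<bullet> ?v - gradient f u \<bullet> ?v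
        - C * t * (norm ?v)\<^sup>2) (at t)"
      unfolding \<psi>_def
      by (rule derivative_eq_intros gradient_has_real_derivative_along_line[OF diff] refl)+ simp
    moreover have "gradient f (u + t *\<^sub>R ?v) \<bullet> ?v - gradient f u \<bullet> ?v \<le> C * t * (norm ?v)\<^sup>2"
    proof -
      have "gradient f (u + t *\<^sub>R ?v) \<bullet> ?v - gradient f u \<bullet> ?v
        \<le> norm (gradient f (u + t *\<^sub>R ?v) - gradient f u) * norm ?v"
        by (simp add: norm_cauchy_schwarz flip: inner_diff_left)
      also have "\<dots> \<le> (C * norm (t *\<^sub>R ?v)) * norm ?v"
        using lipschitz_onD[OF lip, of "u + t *\<^sub>R ?v" u]
        by (intro mult_right_mono) (auto simp: dist_norm)
      finally show ?thesis using t by (simp add: power2_eq_square mult.assoc)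
    qed
    ultimately show "\<exists>D. (\<psi> has_real_derivative D) (at t) \<and> D \<le> 0" by force
  qed simp
  then show ?thesis by (simp add: \<psi>_def)
qed

text \<open>Convexity bounds \<open>f y\<close> from below and smoothness bounds \<open>f z\<close>
  from above, both expanded at \<open>u\<close>. The staleness of \<open>u\<close> thus costs only
  the squared distance from \<open>u\<close> to \<open>z\<close>.\<close>

lemma stale_gradient_inequality:
  fixes f :: "'a::euclidean_space \<Rightarrow> real"
  assumes "f differentiable_on UNIV" "convex_on UNIV f" "C-lipschitz_on UNIV (gradient f)"
  shows "f z - f y \<le> gradient f u \<bullet> (z - y) + C / 2 * (norm (z - u))\<^sup>2"
  using convex_gradient_inequality[OF assms(1,2), of u y]
    lipschitz_gradient_upper_bound[OF assms(1,3), of z u]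
  by (simp add: algebra_simps)

section \<open>Delayed sequences\<close>

text \<open>The difference telescopes into at most \<open>T + 1\<close> increments, and
  Cauchy-Schwarz bounds the square of their sum. The window on the right is enlarged to start at
  \<open>k - T\<close>, so that one bound covers all admissible delays.\<close>

lemma norm_telescope_sq_le:
  fixes x :: "nat \<Rightarrow> 'a::real_normed_vector"
  assumes "j \<le> k" "k \<le> j + T"
  shows "(norm (x (Suc k) - x j))\<^sup>2
    \<le> (real T + 1) * (\<Sum>i=k-T..k. (norm (x (Suc i) - x i))\<^sup>2)"
proof -
  let ?d = "\<lambda>i. norm (x (Suc i) - x i)"
  have "x (Suc k) - x j = (\<Sum>i=j..k. x (Suc i) - x i)"
    using assms(1) by (simp add: sum_Suc_diff)
  then have "norm (x (Suc k) - x j) \<le> (\<Sum>i=j..k. ?d i)"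
    by (metis norm_sum)
  then have "(norm (x (Suc k) - x j))\<^sup>2 \<le> (\<Sum>i=j..k. ?d i)\<^sup>2"
    by (intro power_mono) auto
  also have "\<dots> \<le> real (card {j..k}) * (\<Sum>i=j..k. (?d i)\<^sup>2)"
    using sum_squared_le_sum_of_squares[of ?d "{j..k}"] by (simp add: mult.commute)
  also have "\<dots> \<le> (real T + 1) * (\<Sum>i=k-T..k. (?d i)\<^sup>2)"
    using assms by (intro mult_mono sum_mono2 sum_nonneg) auto
  finally show ?thesis .
qed

text \<open>After weighting and summation the double sum is reordered: \<open>w j\<close> occurs
  only in the windows of \<open>k\<close> with \<open>j \<le> k\<close> and
  \<open>k \<le> j + T\<close>, so its total weight is at most \<open>q ^ j\<close> times the
  geometric sum in \<open>Cq\<close>.\<close>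

lemma delayed_contraction:
  fixes V w :: "nat \<Rightarrow> real"
  assumes q: "q > 0" and w: "\<And>k. w k \<ge> 0" and C: "C \<ge> 0"
    and Cq: "C * (\<Sum>i\<le>T. q ^ i) \<le> 1"
    and step: "\<And>k. q * V (Suc k) \<le> V k - w k + C * (\<Sum>j=k-T..k. w j)"
  shows "q ^ K * V K \<le> V 0"
proof -
  have weighted: "q ^ K * V K + (\<Sum>k<K. q ^ k * w k)
    \<le> V 0 + C * (\<Sum>k<K. q ^ k * (\<Sum>j=k-T..k. w j))" for K
  proof (induction K)
    case (Suc K)
    have "q ^ K * (q * V (Suc K)) \<le> q ^ K * (V K - w K + C * (\<Sum>j=K-T..K. w j))"
      using q step by (intro mult_left_mono) auto
    with Suc.IH show ?case by (simp add: algebra_simps)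
  qed simp
  \<comment> \<open>Writing \<open>k - T \<le> j\<close> as \<open>k \<le> j + T\<close> turns the
    windows into a relation between \<open>k\<close> and \<open>j\<close>, ready for the exchange of
    sums.\<close>
  have "(\<Sum>k<K. q ^ k * (\<Sum>j=k-T..k. w j))
    = (\<Sum>k\<in>{..<K}. \<Sum>j\<in>{j. j \<in> {..<K} \<and> k \<le> j + T \<and> j \<le> k}. q ^ k * w j)"
    by (auto simp: sum_distrib_left intro!: sum.cong)
  also have "\<dots> = (\<Sum>j\<in>{..<K}. \<Sum>k\<in>{k. k \<in> {..<K} \<and> k \<le> j + T \<and> j \<le> k}. q ^ k * w j)"
    by (rule sum.swap_restrict) auto
  \<comment> \<open>Nonnegative terms with \<open>k \<ge> K\<close> are added, so that every
    \<open>j\<close> gets a full geometric sum.\<close>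
  also have "\<dots> \<le> (\<Sum>j<K. \<Sum>k=j..j+T. q ^ k * w j)"
    using q w by (intro sum_mono sum_mono2) auto
  also have "\<dots> = (\<Sum>j<K. q ^ j * w j * (\<Sum>i\<le>T. q ^ i))"
  proof (intro sum.cong refl)
    fix j
    have "(\<Sum>k=j..j+T. q ^ k * w j) = (\<Sum>i=0..T. q ^ (i + j) * w j)"
      using sum.shift_bounds_cl_nat_ivl[of "\<lambda>k. q ^ k * w j" 0 j T] by (simp add: add.commute)
    then show "(\<Sum>k=j..j+T. q ^ k * w j) = q ^ j * w j * (\<Sum>i\<le>T. q ^ i)"
      by (simp add: sum_distrib_left power_add atLeast0AtMost algebra_simps)
  qed
  finally have "C * (\<Sum>k<K. q ^ k * (\<Sum>j=k-T..k. w j))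
    \<le> C * (\<Sum>j<K. q ^ j * w j * (\<Sum>i\<le>T. q ^ i))"
    using C by (rule mult_left_mono)
  also have "\<dots> = (\<Sum>j<K. q ^ j * w j) * (C * (\<Sum>i\<le>T. q ^ i))"
    by (simp only: mult.left_commute[of C] flip: sum_distrib_right)
  also have "\<dots> \<le> (\<Sum>j<K. q ^ j * w j) * 1"
    using q w Cq by (intro mult_left_mono sum_nonneg) auto
  finally show ?thesis using weighted[of K] by simp
qed

text \<open>With q = \<mu> \<alpha> + 1, the geometric series gives \<mu> \<alpha> (1 + q + ... +
  q^T) = q^(T+1) - 1, and the bound on \<open>\<alpha>\<close> says that this is at most \<mu> / (L
  (T+1)).\<close>

lemma step_size_condition:
  fixes \<mu> L \<alpha> :: real
  assumes \<mu>: "\<mu> > 0" and L: "L \<ge> 0" and \<alpha>: "\<alpha> > 0"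
    and le: "\<alpha> \<le> ((1 + \<mu> / L * (1 / (real T + 1))) powr (1 / (real T + 1)) - 1) / \<mu>"
  shows "\<alpha> * L * (real T + 1) * (\<Sum>i\<le>T. (\<mu> * \<alpha> + 1) ^ i) \<le> 1"
proof (cases "L = 0")
  case False
  with L have L: "L > 0" by simp
  let ?m = "real T + 1" and ?q = "\<mu> * \<alpha> + 1"
  have pos: "1 + \<mu> / L * (1 / ?m) > 0"
    using \<mu> L by (intro add_pos_nonneg) auto
  have q: "?q > 0" using \<mu> \<alpha> by (simp add: add_pos_pos)
  have "?q \<le> (1 + \<mu> / L * (1 / ?m)) powr (1 / ?m)"
    using le \<mu> by (simp add: pos_le_divide_eq mult.commute)
  then have "?q powr ?m \<le> ((1 + \<mu> / L * (1 / ?m)) powr (1 / ?m)) powr ?m"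
    using q by (intro powr_mono2) auto
  also have "\<dots> = 1 + \<mu> / L * (1 / ?m)"
    using pos by (simp add: powr_powr)
  finally have "?q ^ Suc T - 1 \<le> \<mu> / L * (1 / ?m)"
    using q powr_realpow[of ?q "Suc T"] by (simp add: add.commute)
  moreover have "?q ^ Suc T - 1 = \<mu> * \<alpha> * (\<Sum>i\<le>T. ?q ^ i)"
    using power_diff_1_eq[of ?q "Suc T"] by (simp add: lessThan_Suc_atMost)
  ultimately have "\<mu> * \<alpha> * (\<Sum>i\<le>T. ?q ^ i) \<le> \<mu> / (L * ?m)" by simp
  then have "\<mu> * \<alpha> * (\<Sum>i\<le>T. ?q ^ i) * (L * ?m) \<le> \<mu>"
    using L by (subst (asm) pos_le_divide_eq) auto
  then have "\<mu> * (\<alpha> * L * ?m * (\<Sum>i\<le>T. ?q ^ i)) \<le> \<mu> * 1"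
    by (simp only: ac_simps mult_1_right)
  then show ?thesis using \<mu> by (simp only: mult_le_cancel_left_pos)
qed simp

theorem theorem1:
  fixes N :: nat
    and f :: "nat \<Rightarrow> real ^ 'd \<Rightarrow> real"
    and F :: "real ^ 'd \<Rightarrow> real"
    and h :: "real ^ 'd \<Rightarrow> ereal"
    and \<mu> L \<alpha> :: real
    and Ln :: "nat \<Rightarrow> real"
    and \<tau> :: "nat \<Rightarrow> nat \<Rightarrow> nat"
    and \<tau>bar :: nat
    and x0 xstar :: "real ^ 'd"
    and x :: "nat \<Rightarrow> real ^ 'd"
  assumes N: "N \<ge> 1"
    and f_diff: "\<forall>n\<in>{1..N}. f n differentiable_on UNIV"
    and h_proper: "proper_fun h"
    and h_convex: "convex_ereal h"
    and F_def: "F = (\<lambda>z. \<Sum>n=1..N. f n z)"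
    and mu_pos: "\<mu> > 0"
    and A1: "strongly_convex \<mu> F"
    and A2: "\<forall>n\<in>{1..N}. convex_on UNIV (f n) \<and> (Ln n)-lipschitz_on UNIV (gradient (f n))"
    and A3: "\<forall>x\<in>effective_domain h. \<forall>y\<in>effective_domain h.
               subdifferential h y \<noteq> {} \<and>
               (\<forall>s\<in>subdifferential h y. h x \<ge> h y + ereal (s \<bullet> (x - y)))"
    and A4: "\<forall>k. \<forall>n\<in>{1..N}. \<tau> k n \<in> {0..\<tau>bar}"
    and L_def: "L = (\<Sum>n=1..N. Ln n)"
    and xstar: "is_arg_min (\<lambda>z. ereal (F z) + h z) (\<lambda>_. True) xstar"
    and alpha_pos: "\<alpha> > 0"
    and alpha_le: "\<alpha> \<le> ((1 + \<mu> / L * (1 / (real \<tau>bar + 1))) powr (1 / (real \<tau>bar + 1)) - 1) / \<mu>"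
    and iterates: "piag_iterates N f h \<alpha> \<tau> x0 x"
  shows "\<forall>k. (norm (x k - xstar))\<^sup>2 \<le> (1 / (\<mu> * \<alpha> + 1)) ^ k * (norm (x0 - xstar))\<^sup>2"
proof
  fix K
  define q where "q = \<mu> * \<alpha> + 1"
  \<comment> \<open>Twice \<open>\<alpha>\<close> times the factor
    \<open>L / 2 * (real \<tau>bar + 1)\<close> that the stale gradients put on the window sum
    \<open>W\<close>.\<close>
  define C where "C = \<alpha> * L * (real \<tau>bar + 1)"
  define V where "V = (\<lambda>k. (norm (x k - xstar))\<^sup>2)"
  define w where "w = (\<lambda>k. (norm (x (Suc k) - x k))\<^sup>2)"
  have Ln: "Ln n \<ge> 0" if "n \<in> {1..N}" for n
    using A2 that lipschitz_on_nonneg by blast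
  then have L: "L \<ge> 0" unfolding L_def by (rule sum_nonneg)
  have q: "q > 0" using mu_pos alpha_pos by (simp add: q_def add_pos_pos)
  have step: "q * V (Suc k) \<le> V k - w k + C * (\<Sum>j=k-\<tau>bar..k. w j)" for k
  proof -
    define g where "g = aggregated_gradient N f \<tau> x k"
    define W where "W = (\<Sum>j=k-\<tau>bar..k. w j)"
    let ?z = "x (Suc k)"
    have prox: "is_arg_min (\<lambda>y. ereal (g \<bullet> (y - x k) + 1 / (2 * \<alpha>) * (norm (y - x k))\<^sup>2) + h y)
      (\<lambda>_. True) ?z"
      using iterates by (simp add: piag_iterates_def g_def)
    obtain a where a: "h ?z = ereal a"
      using composite_minimizer_finite[OF h_proper prox] by (cases "h ?z") auto
    obtain b where b: "h xstar = ereal b"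
      using composite_minimizer_finite[OF h_proper xstar] by (cases "h xstar") auto
    have "F ?z - F xstar = (\<Sum>n=1..N. f n ?z - f n xstar)"
      by (simp add: F_def sum_subtractf)
    also have "\<dots> \<le> (\<Sum>n=1..N. gradient (f n) (x (k - \<tau> k n)) \<bullet> (?z - xstar)
        + Ln n / 2 * ((real \<tau>bar + 1) * W))"
    proof (rule sum_mono)
      fix n assume n: "n \<in> {1..N}"
      \<comment> \<open>The truncated index \<open>k - \<tau> k n\<close> is at most
        \<open>k\<close>, and adding \<open>\<tau>bar\<close> to it gives at least \<open>k\<close>,
        even when the delay exceeds \<open>k\<close>.\<close>
      have "(norm (?z - x (k - \<tau> k n)))\<^sup>2 \<le> (real \<tau>bar + 1) * W"
        unfolding W_def w_def using A4[rule_format, OF n, of k]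
        by (intro norm_telescope_sq_le) auto
      then have "Ln n / 2 * (norm (?z - x (k - \<tau> k n)))\<^sup>2 \<le> Ln n / 2 * ((real \<tau>bar + 1) * W)"
        using Ln[OF n] by (intro mult_left_mono) auto
      moreover have "f n ?z - f n xstar \<le> gradient (f n) (x (k - \<tau> k n)) \<bullet> (?z - xstar)
          + Ln n / 2 * (norm (?z - x (k - \<tau> k n)))\<^sup>2"
        using f_diff A2 n by (intro stale_gradient_inequality) auto
      ultimately show "f n ?z - f n xstar \<le> gradient (f n) (x (k - \<tau> k n)) \<bullet> (?z - xstar)
          + Ln n / 2 * ((real \<tau>bar + 1) * W)"
        by linarith
    qed
    also have "\<dots> = g \<bullet> (?z - xstar) + L / 2 * ((real \<tau>bar + 1) * W)"
      by (simp add: g_def aggregated_gradient_def L_def sum.distrib inner_sum_left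
          sum_distrib_right sum_divide_distrib)
    finally have "F ?z - F xstar \<le> g \<bullet> (?z - xstar) + L / 2 * ((real \<tau>bar + 1) * W)" .
    \<comment> \<open>Growth of \<open>F + h\<close> around \<open>xstar\<close> bounds the same
      difference of \<open>F\<close> from below; its term in \<open>\<mu>\<close> is the source of
      the \<open>\<mu> * \<alpha>\<close> in \<open>q\<close>.\<close>
    moreover have "F xstar + b + \<mu> / 2 * (norm (?z - xstar))\<^sup>2 \<le> F ?z + a"
      using strongly_convex_combination[OF A1]
      by (rule composite_minimizer_growth[OF _ h_convex xstar b a])
    ultimately have "\<mu> / 2 * V (Suc k) - L / 2 * ((real \<tau>bar + 1) * W)
        \<le> g \<bullet> (?z - xstar) + a - b"
      by (simp add: V_def)
    then have "2 * \<alpha> * (\<mu> / 2 * V (Suc k) - L / 2 * ((real \<tau>bar + 1) * W))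
        \<le> 2 * \<alpha> * (g \<bullet> (?z - xstar) + a - b)"
      using alpha_pos by (intro mult_left_mono) auto
    \<comment> \<open>The term \<open>- V (Suc k)\<close>, moved to the left, supplies the 1 in
      \<open>q\<close>.\<close>
    also have "\<dots> \<le> V k - w k - V (Suc k)"
      unfolding V_def w_def by (rule prox_step_inequality[OF alpha_pos h_convex prox a b])
    finally show ?thesis
      by (simp add: q_def C_def W_def algebra_simps)
  qed
  have "q ^ K * V K \<le> V 0"
  proof (rule delayed_contraction[where V = V and w = w and C = C and T = \<tau>bar])
    show "C * (\<Sum>i\<le>\<tau>bar. q ^ i) \<le> 1"
      unfolding C_def q_def by (rule step_size_condition[OF mu_pos L alpha_pos alpha_le])
  qed (use q step L alpha_pos in \<open>auto simp: w_def C_def\<close>)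
  moreover have "x 0 = x0" using iterates by (simp add: piag_iterates_def)
  ultimately show "(norm (x K - xstar))\<^sup>2 \<le> (1 / (\<mu> * \<alpha> + 1)) ^ K * (norm (x0 - xstar))\<^sup>2"
    unfolding q_def[symmetric] using q
    by (simp add: V_def power_one_over pos_le_divide_eq mult.commute)
qed

end
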